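(* Let $S$ be a finite semigroup. The enhanced power graph $P_e(S)$ is equal to the commuting graph $P_c(S)$ if and only if all of the following hold: (i) For $f,f'\in E(S)$ such that $ff'=f'f$, we have $f=f'$. (ii) $S$ has no subgroup (isomorphic to) $C_p\times C_p$ for $p$ prime. (iii) For all $x,y\in S$ with $xy=yx$ and at least one of $m_x,m_y$ greater than $1$, we have $x,y\in\langle z\rangle$ for some $z\in S$.
   Context: $\mathbb{N}$ is the set of positive integers. $E(S)$ is the set of idempotents of $S$. For $a\in S$, $\langle a\rangle=\{a^k:k\in\mathbb{N}\}$, and $m_a$ denotes the index of $a$: the least $x\in\mathbb{N}$ such that $a^x=a^y$ for some $y\in\mathbb{N}$ with $y\neq x$. $C_n$ is the cyclic group of order $n$. A subgroup of $S$ is a subsemigroup of $S$ that is a group under the operation of $S$ (with its own identity element). Both graphs are simple graphs with vertex set $S$. In $P_e(S)$, distinct $x,y$ are adjacent if and only if there is $z\in S$ with $x,y\in\langle z\rangle$. In $P_c(S)$, distinct $x,y$ are adjacent if and only if $xy=yx$. Two graphs on $S$ are equal if they have the same edges. *)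

theory Defs
  imports
    "HOL-Algebra.Elementary_Groups"
    "HOL-Computational_Algebra.Primes"
    "Graph_Theory.Pair_Digraph"
begin

text \<open>
  A finite semigroup is a type of class \<open>{finite, semigroup_mult}\<close>; the semigroup \<open>S\<close> is
  the whole type.
\<close>

text \<open>
  A semigroup need not have a unit, so the library's \<open>power\<close> is not available. The power
  \<open>a\<^sup>k\<close> is the \<open>k\<close>-fold product and is meaningful only for \<open>k \<ge> 1\<close> (at \<open>k = 0\<close> the truncated
  subtraction yields \<open>a\<close>), so all exponents below are restricted to be positive.
\<close>

definition sg_power :: "'a::semigroup_mult \<Rightarrow> nat \<Rightarrow> 'a" where
  "sg_power a k = (((*) a) ^^ (k - 1)) a"

lemma sg_power_1: "sg_power a 1 = a"
  by (simp add: sg_power_def)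

lemma sg_power_Suc: "k \<ge> 1 \<Longrightarrow> sg_power a (Suc k) = a * sg_power a k"
  by (cases k) (simp_all add: sg_power_def)

definition monogenic :: "'a::semigroup_mult \<Rightarrow> 'a set" where
  "monogenic a = {sg_power a k |k. k \<ge> 1}"

definition sg_index :: "'a::semigroup_mult \<Rightarrow> nat" where
  "sg_index a = (LEAST x. x \<ge> 1 \<and> (\<exists>y\<ge>1. y \<noteq> x \<and> sg_power a x = sg_power a y))"

definition idempotents :: "'a::semigroup_mult set" where
  "idempotents = {e. e * e = e}"

text \<open>
  The subsemigroup \<open>H\<close> as a group with identity \<open>e\<close>. The identity belongs to \<open>H\<close>,
  and it need not be an identity of the surrounding semigroup.
\<close>

definition subgroup_struct :: "'a::semigroup_mult set \<Rightarrow> 'a \<Rightarrow> 'a monoid" where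
  "subgroup_struct H e = \<lparr>carrier = H, monoid.mult = (*), one = e\<rparr>"

definition has_subgroup_iso_to :: "'a::semigroup_mult itself \<Rightarrow> ('b, 'c) monoid_scheme \<Rightarrow> bool" where
  "has_subgroup_iso_to _ G \<longleftrightarrow>
     (\<exists>(H :: 'a set) e. group (subgroup_struct H e) \<and> subgroup_struct H e \<cong> G)"

text \<open>
  As in the Graph\_Theory library, a simple graph is a loop-free symmetric digraph without
  parallel arcs (locale \<open>pair_graph\<close>): each undirected edge \<open>{x, y}\<close> is represented by the two
  arcs \<open>(x, y)\<close> and \<open>(y, x)\<close>.
\<close>

definition enhanced_power_graph :: "'a::semigroup_mult pair_pre_digraph" where
  "enhanced_power_graph =
     \<lparr>pverts = UNIV,
      parcs = {(x, y). x \<noteq> y \<and> (\<exists>z. x \<in> monogenic z \<and> y \<in> monogenic z)}\<rparr>"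

definition commuting_graph :: "'a::semigroup_mult pair_pre_digraph" where
  "commuting_graph = \<lparr>pverts = UNIV, parcs = {(x, y). x \<noteq> y \<and> x * y = y * x}\<rparr>"

lemma pair_graph_enhanced_power_graph:
  "pair_graph (enhanced_power_graph :: 'a::{finite, semigroup_mult} pair_pre_digraph)"
  by unfold_locales (auto simp: enhanced_power_graph_def symmetric_def intro!: symI)

lemma pair_graph_commuting_graph:
  "pair_graph (commuting_graph :: 'a::{finite, semigroup_mult} pair_pre_digraph)"
  by unfold_locales (auto simp: commuting_graph_def symmetric_def intro!: symI)

end

theory Submission
  imports Defs "HOL-Algebra.Multiplicative_Group"
begin

text \<open>
  Elements of one monogenic subsemigroup commute, and every \<open>x\<close> lies in \<open>\<langle>x\<rangle>\<close>, so the graphs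
  agree iff any two commuting elements are powers of a common element; call this property \<open>C\<close>.

  If \<open>C\<close> holds, commuting idempotents coincide because a monogenic semigroup has at most one
  idempotent. A subgroup \<open>C\<^sub>p \<times> C\<^sub>p\<close> would have commuting generators \<open>a = z\<^sup>k\<close> and \<open>b = z\<^sup>l\<close>
  for some \<open>z\<close>, possibly outside the subgroup. Replacing \<open>z\<close> by \<open>z\<^sup>g\<close> with \<open>g = gcd k l\<close> makes
  the exponents coprime, but \<open>a\<^sup>l = b\<^sup>k\<close> then forces \<open>p\<close> to divide both of them.

  For the converse, the index condition leaves only commuting \<open>x\<close> and \<open>y\<close> of index 1. Each of
  them belongs to a subgroup whose identity is one of its own powers. These two idempotents
  commute, hence are equal, and \<open>x\<close> and \<open>y\<close> lie in one maximal subgroup. It remains to see that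
  commuting group elements of finite order generate a cyclic group unless there is a
  \<open>C\<^sub>p \<times> C\<^sub>p\<close>. Instead of the structure theorem for finite abelian groups, this uses a descent on
  \<open>ord x + ord y\<close>. If the orders are coprime, \<open>x y\<close> generates both elements. Otherwise a
  prime \<open>p\<close> divides both orders; in the absence of \<open>C\<^sub>p \<times> C\<^sub>p\<close> the powers of order \<open>p\<close> of \<open>x\<close>
  and of \<open>y\<close> generate the same subgroup, and this allows the order of one of the two elements
  to be lowered by multiplying it by a power of the other (lemmas \<open>order_descent\<close> and
  \<open>commuting_imp_common_cyclic\<close>).
\<close>

section \<open>Commuting elements of finite order in a group\<close>

context group
begin

lemma int_pow_commute:
  assumes "x \<otimes> y = y \<otimes> x" "x \<in> carrier G" "y \<in> carrier G"
  shows "x [^] (i::int) \<otimes> y [^] (j::int) = y [^] j \<otimes> x [^] i"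
proof -
  have single: "a [^] (i::int) \<otimes> b = b \<otimes> a [^] i"
    if "a \<otimes> b = b \<otimes> a" "a \<in> carrier G" "b \<in> carrier G" for a b i
  proof (cases i rule: int_cases2)
    case (nonneg n)
    then show ?thesis
      using that by (simp add: int_pow_int group_commutes_pow)
  next
    case (nonpos n)
    have "a [^] n \<otimes> b = b \<otimes> a [^] n"
      using that by (simp add: group_commutes_pow)
    then have "a [^] n \<otimes> (b \<otimes> inv (a [^] n)) = b \<otimes> a [^] n \<otimes> inv (a [^] n)"
      using that by (simp flip: m_assoc)
    then have "a [^] n \<otimes> (b \<otimes> inv (a [^] n)) = b"
      using that by (simp add: m_assoc)
    then have "inv (a [^] n) \<otimes> b = b \<otimes> inv (a [^] n)"
      using that inv_solve_left[of "b \<otimes> inv (a [^] n)" "a [^] n" b] by simp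
    then show ?thesis
      using that nonpos by (simp add: int_pow_neg_int)
  qed
  show ?thesis
    using assms by (intro single[symmetric] single int_pow_closed)
qed

text \<open>
  The map \<open>(i, j) \<mapsto> u\<^sup>i v\<^sup>j\<close> is a homomorphism from \<open>C\<^sub>p \<times> C\<^sub>p\<close>. If \<open>(i, j)\<close> is in its kernel
  with \<open>j\<close> nonzero modulo \<open>p\<close>, then inverting \<open>j\<close> modulo \<open>p\<close> expresses \<open>v\<close> as a power of \<open>u\<close>.
  So \<open>j = 0\<close>, and \<open>i = 0\<close> follows from the order of \<open>u\<close>.
\<close>

lemma prime_order_elementary_abelian:
  fixes p :: nat
  assumes p: "prime p"
    and u: "u \<in> carrier G" "ord u = p" and v: "v \<in> carrier G" "ord v = p"
    and comm: "u \<otimes> v = v \<otimes> u" and indep: "\<And>k::int. v \<noteq> u [^] k"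
  shows "\<exists>H. subgroup H G \<and> G\<lparr>carrier := H\<rparr> \<cong> integer_mod_group p \<times>\<times> integer_mod_group p"
proof -
  let ?Z = "integer_mod_group p \<times>\<times> integer_mod_group p"
  let ?h = "\<lambda>(i, j). u [^] (i::int) \<otimes> v [^] (j::int)"
  have p0: "p > 0"
    using p by (simp add: prime_gt_0_nat)
  have red: "w [^] (i mod int p) = w [^] i" if "w \<in> carrier G" "ord w = p" for w and i :: int
    using that by (simp only: int_pow_eq dvd_minus_mod)
  have Z: "group ?Z"
    by (simp add: DirProd_group)
  have hom: "?h \<in> hom ?Z G"
  proof (rule homI)
    fix a b
    assume "a \<in> carrier ?Z" "b \<in> carrier ?Z"
    obtain i j k l where [simp]: "a = (i, j)" "b = (k, l)"
      by (cases a, cases b)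
    have "?h (a \<otimes>\<^bsub>?Z\<^esub> b) = u [^] (i + k) \<otimes> v [^] (j + l)"
      using u v by (simp add: red)
    also have "\<dots> = u [^] i \<otimes> (u [^] k \<otimes> v [^] j) \<otimes> v [^] l"
      using u v by (simp add: int_pow_mult m_assoc)
    also have "u [^] k \<otimes> v [^] j = v [^] j \<otimes> u [^] k"
      using comm u(1) v(1) by (rule int_pow_commute)
    finally show "?h (a \<otimes>\<^bsub>?Z\<^esub> b) = ?h a \<otimes> ?h b"
      using u v by (simp add: m_assoc)
  qed (use u v in auto)
  interpret h: group_hom ?Z G ?h
    using Z hom group_axioms by (simp add: group_hom_def group_hom_axioms_def)
  have "inj_on ?h (carrier ?Z)"
    unfolding h.inj_on_one_iff
  proof (intro allI impI)
    fix a
    assume a: "a \<in> carrier ?Z" and one: "?h a = \<one>"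
    obtain i j where ij [simp]: "a = (i, j)"
      by (cases a)
    have range: "0 \<le> i" "i < int p" "0 \<le> j" "j < int p"
      using a p0 by (auto simp: carrier_integer_mod_group)
    have vj: "v [^] j = u [^] (- i)"
    proof -
      have "v [^] j \<otimes> u [^] i = \<one>"
        using one int_pow_commute[OF comm u(1) v(1), of i j] by simp
      then show ?thesis
        using u(1) v(1) inv_equality[of "v [^] j" "u [^] i"] by (simp add: int_pow_neg)
    qed
    have j: "j = 0"
    proof (rule ccontr)
      assume "j \<noteq> 0"
      then have "\<not> int p dvd j"
        using range zdvd_not_zless by force
      then have "coprime (int p) j"
        using p by (simp add: prime_imp_coprime)
      then obtain s t where "s * int p + t * j = 1"
        using bezout_int by (metis coprime_imp_gcd_eq_1)
      then have "v = v [^] (s * int p + t * j)"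
        using v by simp
      also have "\<dots> = v [^] (j * t)"
        using v by (subst int_pow_eq) (simp_all add: algebra_simps)
      also have "\<dots> = (u [^] (- i)) [^] t"
        using v by (simp add: vj flip: int_pow_pow)
      also have "\<dots> = u [^] (- i * t)"
        using u by (simp only: int_pow_pow)
      finally show False
        using indep by blast
    qed
    have "u [^] i = \<one>"
      using one u j by simp
    then have "int p dvd i"
      using u by (simp add: int_pow_eq_id)
    then have "i = 0"
      using range zdvd_not_zless by force
    with j show "a = \<one>\<^bsub>?Z\<^esub>"
      by simp
  qed
  then have "?h \<in> iso ?Z (G\<lparr>carrier := ?h ` carrier ?Z\<rparr>)"
    using hom by (auto simp: iso_def hom_def bij_betw_def)
  then have "G\<lparr>carrier := ?h ` carrier ?Z\<rparr> \<cong> ?Z"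
    using group.iso_sym[OF Z] is_isoI by blast
  then show ?thesis
    using h.img_is_subgroup by blast
qed

text \<open>
  Write \<open>M = ord x / p\<close>, \<open>N = ord y / p\<close> and \<open>g = gcd M N\<close>. Here \<open>y\<^sup>N\<close> is a power of
  \<open>x\<^sup>M\<close>, and the aim is \<open>c\<close> with \<open>(x\<^sup>c)\<^sup>N\<close> inverse to \<open>y\<^sup>N\<close>. For \<open>c\<close> a multiple of \<open>M / g\<close>, the
  power \<open>x\<^sup>c\<^sup>N\<close> is a power of \<open>(x\<^sup>M)\<^sup>N\<^sup>/\<^sup>g\<close>, and \<open>x\<^sup>M\<close> has order \<open>p\<close>; since \<open>N / g\<close> is
  invertible modulo \<open>p\<close>, every power of \<open>x\<^sup>M\<close> is reached.
\<close>

lemma order_descent: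
  fixes p :: nat and k :: int
  assumes p: "prime p" and x: "x \<in> carrier G" and y: "y \<in> carrier G"
    and comm: "x \<otimes> y = y \<otimes> x"
    and pdvd: "p dvd ord x" "p dvd ord y" "ord y > 0"
    and eq: "y [^] (ord y div p) = (x [^] (ord x div p)) [^] k"
    and val: "\<not> p dvd (ord y div p) div gcd (ord x div p) (ord y div p)"
  shows "\<exists>c::int. ord (y \<otimes> x [^] c) dvd ord y div p"
proof -
  define M where "M = ord x div p"
  define N where "N = ord y div p"
  define g where "g = gcd M N"
  define N' where "N' = N div g"
  define M' where "M' = M div g"
  have MN: "M = M' * g" "N = N' * g"
    by (simp_all add: M'_def N'_def g_def)
  have "\<not> int p dvd int N'"
    using val by (simp add: N'_def N_def M_def g_def)
  then have "coprime (int p) (int N')"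
    using p by (simp add: prime_imp_coprime)
  then obtain s t where st: "s * int p + t * int N' = 1"
    using bezout_int by (metis coprime_imp_gcd_eq_1)
  (* t inverts N' modulo p, so that c * N = - M * k modulo ord x *)
  define c where "c = - (int M' * k * t)"
  have "int (ord x) = int M * int p"
    using pdvd by (simp add: M_def flip: of_nat_mult)
  then have ordx: "int (ord x) dvd int M * k * int p * s"
    by simp
  have "(y \<otimes> x [^] c) [^] int N = y [^] int N \<otimes> (x [^] c) [^] int N"
    using x y int_pow_commute[OF comm x y, of c 1] by (intro int_pow_mult_distrib) simp_all
  also have "y [^] int N = x [^] (int M * k)"
    using eq x by (simp add: N_def M_def int_pow_int flip: int_pow_pow)
  also have "(x [^] c) [^] int N = x [^] (c * int N)"
    using x by (simp add: int_pow_pow)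
  also have "x [^] (int M * k) \<otimes> x [^] (c * int N) = x [^] (int M * k + c * int N)"
    using x by (simp add: int_pow_mult)
  also have "int M * k + c * int N = int M * k * (1 - t * int N')"
    by (simp add: c_def MN algebra_simps)
  also have "\<dots> = int M * k * int p * s"
    using arg_cong[OF st, of "\<lambda>r. int M * k * r"] by (simp add: algebra_simps)
  also have "x [^] (int M * k * int p * s) = \<one>"
    using x ordx by (simp add: int_pow_eq_id)
  finally have "ord (y \<otimes> x [^] c) dvd N"
    using x y by (simp add: pow_eq_id int_pow_int)
  then show ?thesis
    unfolding N_def by blast
qed

text \<open>
  Hypothesis \<open>dep\<close> expresses the absence of \<open>C\<^sub>p \<times> C\<^sub>p\<close> by elements. Multiplying \<open>y\<close> by a power
  of \<open>x\<close>, or \<open>x\<close> by a power of \<open>y\<close>, does not change the subgroup generated by the two, so it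
  suffices to lower the orders in this way until they are coprime.
\<close>

lemma commuting_imp_common_cyclic:
  assumes "x \<in> carrier G" "y \<in> carrier G" "x \<otimes> y = y \<otimes> x" "ord x > 0" "ord y > 0"
    and dep: "\<And>(p::nat) u v. \<lbrakk>prime p; u \<in> carrier G; v \<in> carrier G; ord u = p; ord v = p;
      u \<otimes> v = v \<otimes> u\<rbrakk> \<Longrightarrow> \<exists>k::int. v = u [^] k"
  shows "\<exists>z\<in>carrier G. \<exists>(i::int) (j::int). x = z [^] i \<and> y = z [^] j"
  using assms(1-5)
proof (induction "ord x + ord y" arbitrary: x y rule: less_induct)
  case less
  have x: "x \<in> carrier G" and y: "y \<in> carrier G" and comm: "x \<otimes> y = y \<otimes> x"
    and pos: "ord x > 0" "ord y > 0"
    using less.prems by auto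
  show ?case
  proof (cases "coprime (ord x) (ord y)")
    case True
    then have "coprime (int (ord x)) (int (ord y))"
      by simp
    then obtain s t where st: "s * int (ord x) + t * int (ord y) = 1"
      using bezout_int by (metis coprime_imp_gcd_eq_1)
    (* By the Chinese remainder theorem, x and y are both powers of their product. *)
    have bez: "1 - t * int (ord y) = s * int (ord x)" "1 - s * int (ord x) = t * int (ord y)"
      using st by linarith+
    have pow: "(x \<otimes> y) [^] i = x [^] i \<otimes> y [^] i" for i :: int
      using comm x y by (rule int_pow_mult_distrib)
    have "x [^] (t * int (ord y)) = x [^] (1::int)"
      using x bez by (simp only: int_pow_eq dvd_triv_right)
    moreover have "y [^] (t * int (ord y)) = \<one>"
      using y by (simp add: int_pow_eq_id)
    ultimately have "x = (x \<otimes> y) [^] (t * int (ord y))"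
      using x by (simp add: pow)
    moreover have "y [^] (s * int (ord x)) = y [^] (1::int)"
      using y bez by (simp only: int_pow_eq dvd_triv_right)
    moreover have "x [^] (s * int (ord x)) = \<one>"
      using x by (simp add: int_pow_eq_id)
    ultimately show ?thesis
      using x y pow by (metis int_pow_1 l_one m_closed)
  next
    case False
    then have "gcd (ord x) (ord y) \<noteq> 1"
      by (simp add: coprime_iff_gcd_eq_1)
    then obtain p where "prime p" "p dvd gcd (ord x) (ord y)"
      using prime_factor_nat by blast
    then have p: "prime p" "p dvd ord x" "p dvd ord y"
      by simp_all
    define M where "M = ord x div p"
    define N where "N = ord y div p"
    have quot: "M dvd ord x" "M \<noteq> 0" "ord x div M = p" "N dvd ord y" "N \<noteq> 0" "ord y div N = p"
      using p pos by (auto simp: M_def N_def prime_gt_0_nat elim!: dvdE)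
    have small: "M < ord x" "N < ord y"
      using prime_gt_1_nat[OF p(1)] pos by (simp_all add: M_def N_def)
    have ords: "ord (x [^] M) = p" "ord (y [^] N) = p"
      using quot x y by (simp_all add: ord_pow)
    have comm': "x [^] M \<otimes> y [^] N = y [^] N \<otimes> x [^] M"
      using int_pow_commute[OF comm x y, of "int M" "int N"] by (simp add: int_pow_int)
    (* The prime p misses one of the two coprime cofactors; order_descent then lowers the
       order of y or that of x, respectively. *)
    have "gcd M N \<noteq> 0"
      using quot by simp
    then have "coprime (M div gcd M N) (N div gcd M N)"
      by (intro div_gcd_coprime) auto
    then have "\<not> p dvd M div gcd M N \<or> \<not> p dvd N div gcd M N"
      using p(1) by (meson coprime_common_divisor not_prime_unit)
    then show ?thesis
    proof
      assume val: "\<not> p dvd N div gcd M N"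
      obtain k :: int where "y [^] N = (x [^] M) [^] k"
        using dep[OF p(1) _ _ ords comm'] x y by auto
      then obtain c :: int where c: "ord (y \<otimes> x [^] c) dvd N"
        using order_descent[OF p(1) x y comm p(2,3) pos(2)] val by (auto simp: M_def N_def)
      let ?y = "y \<otimes> x [^] c"
      have "0 < ord ?y" "ord ?y < ord y"
        using c quot small by (auto dest: dvd_imp_le intro: Nat.gr0I)
      moreover have "x \<otimes> ?y = ?y \<otimes> x"
      proof -
        have "x \<otimes> ?y = y \<otimes> (x \<otimes> x [^] c)"
          using x y by (simp add: comm flip: m_assoc)
        also have "x \<otimes> x [^] c = x [^] c \<otimes> x"
          using int_pow_commute[OF refl x x, of 1 c] x by simp
        finally show ?thesis
          using x y by (simp add: m_assoc)
      qed
      ultimately obtain z and i j :: int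
        where z: "z \<in> carrier G" "x = z [^] i" "?y = z [^] j"
        using less.hyps[of x ?y] x y pos by auto
      have "y = ?y \<otimes> x [^] (- c)"
        using x y by (simp add: int_pow_neg m_assoc)
      also have "\<dots> = z [^] (j + i * (- c))"
        using z by (simp only: int_pow_mult int_pow_pow)
      finally show ?thesis
        using z by blast
    next
      assume val: "\<not> p dvd M div gcd M N"
      obtain k :: int where "x [^] M = (y [^] N) [^] k"
        using dep[OF p(1) _ _ ords(2,1) comm'[symmetric]] x y by auto
      then obtain c :: int where c: "ord (x \<otimes> y [^] c) dvd M"
        using order_descent[OF p(1) y x comm[symmetric] p(3,2) pos(1)] val
        by (auto simp: M_def N_def gcd.commute)
      let ?x = "x \<otimes> y [^] c"
      have "0 < ord ?x" "ord ?x < ord x"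
        using c quot small by (auto dest: dvd_imp_le intro: Nat.gr0I)
      moreover have "?x \<otimes> y = y \<otimes> ?x"
      proof -
        have "y \<otimes> ?x = x \<otimes> (y \<otimes> y [^] c)"
          using x y by (simp add: comm[symmetric] flip: m_assoc)
        also have "y \<otimes> y [^] c = y [^] c \<otimes> y"
          using int_pow_commute[OF refl y y, of 1 c] y by simp
        finally show ?thesis
          using x y by (simp add: m_assoc)
      qed
      ultimately obtain z and i j :: int
        where z: "z \<in> carrier G" "?x = z [^] i" "y = z [^] j"
        using less.hyps[of ?x y] x y pos by auto
      have "x = ?x \<otimes> y [^] (- c)"
        using x y by (simp add: int_pow_neg m_assoc)
      also have "\<dots> = z [^] (i + j * (- c))"
        using z by (simp only: int_pow_mult int_pow_pow)
      finally show ?thesis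
        using z by blast
    qed
  qed
qed

end

section \<open>Powers in a semigroup\<close>

lemma sg_power_add:
  assumes "k \<ge> 1" "l \<ge> 1"
  shows "sg_power a (k + l) = sg_power a k * sg_power a l"
  using assms(1)
proof (induction k rule: nat_induct_at_least)
  case base
  then show ?case
    using assms(2) sg_power_Suc[of l a] sg_power_1[of a] by simp
next
  case (Suc k)
  then show ?case
    using sg_power_Suc[of "k + l" a] sg_power_Suc[of k a] by (simp add: mult.assoc)
qed

lemma sg_power_mult:
  assumes "k \<ge> 1" "l \<ge> 1"
  shows "sg_power a (k * l) = sg_power (sg_power a k) l"
  using assms(2)
proof (induction l rule: nat_induct_at_least)
  case base
  then show ?case
    using sg_power_1[of "sg_power a k"] by simp
next
  case (Suc l)
  have "sg_power a (k + k * l) = sg_power a k * sg_power a (k * l)"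
    using assms(1) Suc.hyps by (intro sg_power_add) simp_all
  then show ?case
    using Suc.IH sg_power_Suc[OF Suc.hyps, of "sg_power a k"] by simp
qed

lemma sg_power_idempotent:
  assumes "e * e = e" "k \<ge> 1"
  shows "sg_power e k = e"
  using assms(2)
proof (induction k rule: nat_induct_at_least)
  case base
  show ?case
    by (rule sg_power_1)
next
  case (Suc k)
  then show ?case
    using sg_power_Suc[OF Suc.hyps, of e] assms(1) by simp
qed

lemma monogenic_commute:
  assumes "x \<in> monogenic z" "y \<in> monogenic z"
  shows "x * y = y * x"
proof -
  obtain k l where kl: "k \<ge> 1" "l \<ge> 1" "x = sg_power z k" "y = sg_power z l"
    using assms by (auto simp: monogenic_def)
  then show ?thesis
    using sg_power_add[OF kl(1,2), of z] sg_power_add[OF kl(2,1), of z]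
    by (simp add: add.commute[of l k])
qed

lemma sg_power_commute:
  assumes "x * y = y * x" "k \<ge> 1" "l \<ge> 1"
  shows "sg_power x k * sg_power y l = sg_power y l * sg_power x k"
proof -
  have single: "sg_power a n * b = b * sg_power a n" if "a * b = b * a" "n \<ge> 1" for a b :: 'a and n
    using that(2)
  proof (induction n rule: nat_induct_at_least)
    case base
    show ?case
      using that(1) by (simp only: sg_power_1)
  next
    case (Suc n)
    have "sg_power a (Suc n) * b = a * (sg_power a n * b)"
      using Suc.hyps by (simp only: sg_power_Suc mult.assoc)
    also have "\<dots> = (a * b) * sg_power a n"
      by (simp only: Suc.IH mult.assoc)
    also have "\<dots> = b * sg_power a (Suc n)"
      using Suc.hyps by (simp only: that(1) sg_power_Suc mult.assoc)
    finally show ?case .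
  qed
  show ?thesis
    by (rule single[OF single[OF assms(1,2), symmetric] assms(3), symmetric])
qed

text \<open>
  Idempotents \<open>e = z\<^sup>k\<close> and \<open>f = z\<^sup>l\<close> equal all their own powers, so both equal \<open>z\<^sup>k\<^sup>l\<close>.
\<close>

lemma monogenic_idempotent_unique:
  assumes "e \<in> monogenic z" "f \<in> monogenic z" "e * e = e" "f * f = f"
  shows "e = f"
proof -
  obtain k l where kl: "k \<ge> 1" "l \<ge> 1" "e = sg_power z k" "f = sg_power z l"
    using assms(1,2) by (auto simp: monogenic_def)
  have "e = sg_power e l"
    using assms(3) kl(2) by (simp add: sg_power_idempotent)
  also have "\<dots> = sg_power z (k * l)"
    using kl by (simp add: sg_power_mult)
  also have "\<dots> = sg_power f k"
    using kl by (simp add: mult.commute flip: sg_power_mult)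
  also have "\<dots> = f"
    using assms(4) kl(1) by (simp add: sg_power_idempotent)
  finally show ?thesis .
qed

section \<open>Elements of index one and maximal subgroups\<close>

text \<open>
  The index is a genuine minimum: by finiteness the powers of \<open>x\<close> repeat, so an index of 1 yields
  a repetition of \<open>x\<close> itself.
\<close>

lemma sg_index_le_1_imp_periodic:
  fixes x :: "'a::{finite, semigroup_mult}"
  assumes "\<not> sg_index x > 1"
  shows "\<exists>k\<ge>1. sg_power x (Suc k) = x"
proof -
  let ?P = "\<lambda>n. n \<ge> 1 \<and> (\<exists>m\<ge>1. m \<noteq> n \<and> sg_power x n = sg_power x m)"
  have "\<not> inj_on (sg_power x) {1..}"
    using finite_imageD infinite_Ici finite by blast
  then have "\<exists>n. ?P n"
    by (auto simp: inj_on_def)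
  then have "?P (sg_index x)"
    unfolding sg_index_def by (rule LeastI_ex)
  with assms obtain m where "m \<ge> 1" "m \<noteq> 1" "sg_power x 1 = sg_power x m"
    by (metis le_antisym not_le)
  then show ?thesis
    using sg_power_1[of x] by (intro exI[of _ "m - 1"]) auto
qed

text \<open>
  The group of units of the local monoid \<open>e S e\<close>, which is the largest subgroup of the semigroup
  with identity \<open>e\<close> when \<open>e\<close> is idempotent.
\<close>

definition max_subgroup :: "'a::semigroup_mult \<Rightarrow> 'a set" where
  "max_subgroup e = {a. e * a = a \<and> a * e = a \<and>
     (\<exists>b. e * b = b \<and> b * e = b \<and> a * b = e \<and> b * a = e)}"

lemma group_max_subgroup:
  assumes e: "e * e = (e::'a::semigroup_mult)"
  shows "group (subgroup_struct (max_subgroup e) e)"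
proof (rule groupI)
  fix a c
  assume "a \<in> carrier (subgroup_struct (max_subgroup e) e)"
    "c \<in> carrier (subgroup_struct (max_subgroup e) e)"
  then obtain b d where a: "e * a = a" "a * e = a" "e * b = b" "b * e = b" "a * b = e" "b * a = e"
    and c: "e * c = c" "c * e = c" "e * d = d" "d * e = d" "c * d = e" "d * c = e"
    by (auto simp: subgroup_struct_def max_subgroup_def)
  have "e * (a * c) = a * c" "a * c * e = a * c" "e * (d * b) = d * b" "d * b * e = d * b"
    "a * c * (d * b) = e" "d * b * (a * c) = e"
    using a c by (metis mult.assoc)+
  then show "a \<otimes>\<^bsub>subgroup_struct (max_subgroup e) e\<^esub> c
      \<in> carrier (subgroup_struct (max_subgroup e) e)"
    by (auto simp: subgroup_struct_def max_subgroup_def)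
qed (use e in \<open>auto simp: subgroup_struct_def max_subgroup_def mult.assoc\<close>)

text \<open>
  If \<open>x\<^sup>k\<^sup>+\<^sup>1 = x\<close>, then exponents of \<open>x\<close> only matter modulo \<open>k\<close>. Hence \<open>x\<^sup>k\<close> acts as an
  identity on all powers of \<open>x\<close>, and the inverse of \<open>x\<close> is \<open>x\<^sup>2\<^sup>k\<^sup>-\<^sup>1\<close>.
\<close>

lemma periodic_in_max_subgroup:
  fixes x :: "'a::semigroup_mult"
  assumes k: "k \<ge> 1" and per: "sg_power x (Suc k) = x"
  defines "e \<equiv> sg_power x k"
  shows "e * e = e" "x \<in> max_subgroup e"
proof -
  have shift: "sg_power x (n + k) = sg_power x n" if "n \<ge> 1" for n
    using that
  proof (induction n rule: nat_induct_at_least)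
    case base
    then show ?case
      using per sg_power_1[of x] by simp
  next
    case (Suc n)
    then show ?case
      using sg_power_Suc[of "n + k" x] sg_power_Suc[of n x] by simp
  qed
  have ee: "sg_power x n * e = sg_power x n" "e * sg_power x n = sg_power x n" if "n \<ge> 1" for n
    using shift[OF that] sg_power_add[OF that k, of x] sg_power_add[OF k that, of x]
    by (simp_all add: e_def add.commute)
  show idem: "e * e = e"
    using ee(1)[OF k] by (simp add: e_def)
  (* The natural exponent k - 1 may be 0, hence the shift by k. *)
  define b where "b = sg_power x (2 * k - 1)"
  have "x * b = e" "b * x = e"
    using k shift[OF k] sg_power_add[of 1 "2 * k - 1" x] sg_power_add[of "2 * k - 1" 1 x]
      sg_power_1[of x] by (simp_all add: b_def e_def flip: mult_2)
  moreover have "x * e = x" "e * x = x" "b * e = b" "e * b = b"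
    using ee[of 1] ee[of "2 * k - 1"] k sg_power_1[of x] by (simp_all add: b_def)
  ultimately show "x \<in> max_subgroup e"
    by (auto simp: max_subgroup_def)
qed

lemma nat_pow_subgroup_struct:
  assumes "group (subgroup_struct H e)" "z \<in> H" "k \<ge> 1"
  shows "z [^]\<^bsub>subgroup_struct H e\<^esub> k = sg_power z k"
  using assms(3)
proof (induction k rule: nat_induct_at_least)
  interpret G: group "subgroup_struct H e" by fact
  {
    case base
    then show ?case
      using assms(2) sg_power_1[of z] G.nat_pow_eone[of z]
      by (simp add: subgroup_struct_def)
  next
    case (Suc k)
    then show ?case
      using assms(2) G.nat_pow_Suc2[of z k] sg_power_Suc[of k z]
      by (simp add: subgroup_struct_def)
  }
qed

text \<open>
  Because \<open>z\<close> has finite order, its powers with nonpositive exponents in the group, including the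
  identity, are also powers of \<open>z\<close> in the semigroup.
\<close>

lemma int_pow_in_monogenic:
  fixes z :: "'a::{finite, semigroup_mult}"
  assumes "group (subgroup_struct H e)" "z \<in> H"
  shows "z [^]\<^bsub>subgroup_struct H e\<^esub> (i::int) \<in> monogenic z"
proof -
  interpret G: group "subgroup_struct H e" by fact
  have z: "z \<in> carrier (subgroup_struct H e)"
    using assms(2) by (simp add: subgroup_struct_def)
  (* Adding the order makes the exponent positive, as required in a semigroup. *)
  define n where "n = nat (i mod int (G.ord z)) + G.ord z"
  have "G.ord z \<ge> 1"
    using z by (intro G.ord_ge_1) auto
  then have n: "n \<ge> 1" "int n = i mod int (G.ord z) + int (G.ord z)"
    by (simp_all add: n_def)
  have "int n - i = int (G.ord z) - (i - i mod int (G.ord z))"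
    by (simp add: n(2))
  then have "int (G.ord z) dvd int n - i"
    by (simp only: dvd_diff dvd_refl dvd_minus_mod)
  then have "z [^]\<^bsub>subgroup_struct H e\<^esub> i = z [^]\<^bsub>subgroup_struct H e\<^esub> n"
    using z by (simp add: G.int_pow_eq flip: int_pow_int)
  also have "\<dots> = sg_power z n"
    using assms n(1) by (rule nat_pow_subgroup_struct)
  finally show ?thesis
    using n(1) by (auto simp: monogenic_def)
qed

section \<open>Equality of the two graphs\<close>

lemma enhanced_power_graph_eq_commuting_graph_iff:
  "enhanced_power_graph = (commuting_graph :: 'a::semigroup_mult pair_pre_digraph) \<longleftrightarrow>
     (\<forall>x y :: 'a. x * y = y * x \<longrightarrow> (\<exists>z. x \<in> monogenic z \<and> y \<in> monogenic z))"
proof -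
  have loop: "x \<in> monogenic x" for x :: 'a
    unfolding monogenic_def using sg_power_1[of x] by force
  have eq: "enhanced_power_graph = (commuting_graph :: 'a pair_pre_digraph) \<longleftrightarrow>
      parcs enhanced_power_graph = parcs (commuting_graph :: 'a pair_pre_digraph)"
    by (simp add: enhanced_power_graph_def commuting_graph_def)
  show ?thesis
    unfolding eq
  proof
    assume arcs: "parcs enhanced_power_graph = parcs (commuting_graph :: 'a pair_pre_digraph)"
    show "\<forall>x y :: 'a. x * y = y * x \<longrightarrow> (\<exists>z. x \<in> monogenic z \<and> y \<in> monogenic z)"
    proof (intro allI impI)
      fix x y :: 'a
      assume "x * y = y * x"
      then have "x = y \<or> (x, y) \<in> parcs enhanced_power_graph"
        unfolding arcs by (simp add: commuting_graph_def)
      then show "\<exists>z. x \<in> monogenic z \<and> y \<in> monogenic z"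
        using loop by (auto simp: enhanced_power_graph_def)
    qed
  next
    assume "\<forall>x y :: 'a. x * y = y * x \<longrightarrow> (\<exists>z. x \<in> monogenic z \<and> y \<in> monogenic z)"
    then show "parcs enhanced_power_graph = parcs (commuting_graph :: 'a pair_pre_digraph)"
      by (auto simp: enhanced_power_graph_def commuting_graph_def dest: monogenic_commute)
  qed
qed

text \<open>
  The common root \<open>z\<close> of the two generators need not lie in the subgroup. The argument therefore
  passes to coprime exponents inside \<open>\<langle>z\<rangle>\<close> and uses the group only for the relation
  \<open>a\<^sup>l = b\<^sup>k\<close>, which contains no \<open>z\<close>.
\<close>

lemma common_monogenic_imp_no_Cp_Cp:
  fixes p :: nat
  assumes common: "\<And>x y :: 'a::semigroup_mult. x * y = y * x \<Longrightarrow>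
      \<exists>z. x \<in> monogenic z \<and> y \<in> monogenic z"
    and p: "prime p"
  shows "\<not> has_subgroup_iso_to TYPE('a) (integer_mod_group p \<times>\<times> integer_mod_group p)"
proof
  let ?Z = "integer_mod_group p \<times>\<times> integer_mod_group p"
  assume "has_subgroup_iso_to TYPE('a) ?Z"
  then obtain H :: "'a set" and e h where H: "group (subgroup_struct H e)"
    and h: "h \<in> iso (subgroup_struct H e) ?Z"
    by (auto simp: has_subgroup_iso_to_def is_iso_def)
  let ?G = "subgroup_struct H e"
  interpret G: group ?G by fact
  have carr: "carrier ?G = H" and mult: "monoid.mult ?G = (*)"
    by (simp_all add: subgroup_struct_def)
  have hom: "h \<in> hom ?G ?Z" and bij: "bij_betw h H (carrier ?Z)"
    using h by (auto simp: iso_def carr)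
  have gens: "(1, 0) \<in> carrier ?Z" "(0, 1) \<in> carrier ?Z"
    using p by auto
  obtain a b where ab: "a \<in> H" "b \<in> H" "h a = (1, 0)" "h b = (0, 1)"
    using gens bij by (metis bij_betw_imp_surj_on imageE)
  have "h (a * b) = h (b * a)"
    using hom_mult[OF hom] ab by (simp add: carr mult)
  then have "a * b = b * a"
    using bij ab G.m_closed by (simp add: bij_betw_def inj_on_def carr mult)
  then obtain z k l where kl: "k \<ge> 1" "l \<ge> 1" "a = sg_power z k" "b = sg_power z l"
    using common[of a b] by (auto simp: monogenic_def)
  define g where "g = gcd k l"
  define k' where "k' = k div g"
  define l' where "l' = l div g"
  have g: "g \<ge> 1" "k = g * k'" "l = g * l'" "k' \<ge> 1" "l' \<ge> 1" "coprime k' l'"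
    using kl by (auto simp: g_def k'_def l'_def div_gcd_coprime Suc_le_eq div_greater_zero_iff)
  define w where "w = sg_power z g"
  have w: "a = sg_power w k'" "b = sg_power w l'"
    using kl g by (simp_all add: w_def flip: sg_power_mult)
  have "sg_power a l' = sg_power b k'"
    using g by (simp add: w mult.commute flip: sg_power_mult)
  then have "a [^]\<^bsub>?G\<^esub> l' = b [^]\<^bsub>?G\<^esub> k'"
    using nat_pow_subgroup_struct[OF H] ab g by simp
  then have "h a [^]\<^bsub>?Z\<^esub> l' = h b [^]\<^bsub>?Z\<^esub> k'"
    using hom_nat_pow[OF hom _ H, of a l'] hom_nat_pow[OF hom _ H, of b k'] ab
    by (simp add: carr DirProd_group)
  moreover have "(x, y) [^]\<^bsub>?Z\<^esub> n = (x [^]\<^bsub>integer_mod_group p\<^esub> n, y [^]\<^bsub>integer_mod_group p\<^esub> n)"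
    for x y and n :: nat
    by (induction n) auto
  ultimately have "int l' mod int p = 0" "int k' mod int p = 0"
    using ab by simp_all
  then have "p dvd l'" "p dvd k'"
    by (simp_all add: mod_eq_0_iff_dvd)
  with g(6) p show False
    using coprime_common_divisor not_prime_unit by blast
qed

text \<open>
  The hypothesis on idempotents puts \<open>x\<close> and \<open>y\<close> in the same maximal subgroup, where the
  absence of \<open>C\<^sub>p \<times> C\<^sub>p\<close> supplies a common cyclic subgroup.
\<close>

lemma periodic_commuting_common_monogenic:
  fixes x y :: "'a::{finite, semigroup_mult}"
  assumes idem: "\<And>f f' :: 'a. \<lbrakk>f * f = f; f' * f' = f'; f * f' = f' * f\<rbrakk> \<Longrightarrow> f = f'"
    and noCC: "\<And>p::nat. prime p \<Longrightarrow>
      \<not> has_subgroup_iso_to TYPE('a) (integer_mod_group p \<times>\<times> integer_mod_group p)"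
    and comm: "x * y = y * x"
    and index: "\<not> sg_index x > 1" "\<not> sg_index y > 1"
  shows "\<exists>z. x \<in> monogenic z \<and> y \<in> monogenic z"
proof -
  obtain k l where kl: "k \<ge> 1" "sg_power x (Suc k) = x" "l \<ge> 1" "sg_power y (Suc l) = y"
    using sg_index_le_1_imp_periodic index by metis
  define e where "e = sg_power x k"
  have ex: "e * e = e" "x \<in> max_subgroup e"
    using periodic_in_max_subgroup[OF kl(1,2)] by (simp_all add: e_def)
  (* Both sides are idempotent, and they commute as powers of commuting elements. *)
  have "e = sg_power y l"
    unfolding e_def
    using periodic_in_max_subgroup(1)[OF kl(1,2)] periodic_in_max_subgroup(1)[OF kl(3,4)]
      sg_power_commute[OF comm kl(1,3)] by (rule idem)
  then have ey: "y \<in> max_subgroup e"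
    using periodic_in_max_subgroup(2)[OF kl(3,4)] by simp
  let ?G = "subgroup_struct (max_subgroup e) e"
  have G: "group ?G"
    using ex(1) by (rule group_max_subgroup)
  interpret G: group ?G by fact
  have carr: "carrier ?G = max_subgroup e" and mult: "monoid.mult ?G = (*)"
    by (simp_all add: subgroup_struct_def)
  have ord: "G.ord a > 0" if "a \<in> carrier ?G" for a
    using G.ord_ge_1[of a] that by force
  have "\<exists>z\<in>carrier ?G. \<exists>(i::int) (j::int). x = z [^]\<^bsub>?G\<^esub> i \<and> y = z [^]\<^bsub>?G\<^esub> j"
  proof (rule G.commuting_imp_common_cyclic)
    fix p :: nat and u v
    assume asm: "prime p" "u \<in> carrier ?G" "v \<in> carrier ?G" "G.ord u = p" "G.ord v = p"
      "u \<otimes>\<^bsub>?G\<^esub> v = v \<otimes>\<^bsub>?G\<^esub> u"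
    show "\<exists>i::int. v = u [^]\<^bsub>?G\<^esub> i"
    proof (rule ccontr)
      assume "\<nexists>i::int. v = u [^]\<^bsub>?G\<^esub> i"
      then obtain H where H: "subgroup H ?G"
        "?G\<lparr>carrier := H\<rparr> \<cong> integer_mod_group p \<times>\<times> integer_mod_group p"
        using G.prime_order_elementary_abelian[OF asm(1,2,4,3,5,6)] by blast
      moreover have "?G\<lparr>carrier := H\<rparr> = subgroup_struct H e"
        by (simp add: subgroup_struct_def)
      ultimately show False
        using noCC[OF asm(1)] G.subgroup_imp_group[OF H(1)]
        by (auto simp: has_subgroup_iso_to_def)
    qed
  qed (use ex ey comm ord in \<open>simp_all add: carr mult\<close>)
  then show ?thesis
    using int_pow_in_monogenic[OF G] carr by blast
qed

theorem theorem4p16: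
  shows "(enhanced_power_graph :: 'a::{finite, semigroup_mult} pair_pre_digraph) = commuting_graph \<longleftrightarrow>
     (\<forall>f\<in>idempotents. \<forall>f'\<in>(idempotents :: 'a set). f * f' = f' * f \<longrightarrow> f = f') \<and>
     \<not> (\<exists>p::nat. prime p \<and>
          has_subgroup_iso_to TYPE('a) (integer_mod_group p \<times>\<times> integer_mod_group p)) \<and>
     (\<forall>x y :: 'a. x * y = y * x \<and> (sg_index x > 1 \<or> sg_index y > 1) \<longrightarrow>
        (\<exists>z. x \<in> monogenic z \<and> y \<in> monogenic z))"
    (is "?eq \<longleftrightarrow> ?idem \<and> ?noCC \<and> ?index")
proof
  assume ?eq
  then have common: "\<exists>z. x \<in> monogenic z \<and> y \<in> monogenic z" if "x * y = y * x" for x y :: 'a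
    using that by (simp add: enhanced_power_graph_eq_commuting_graph_iff)
  have ?idem
  proof (intro ballI impI)
    fix f f' :: 'a
    assume f: "f \<in> idempotents" "f' \<in> idempotents" and "f * f' = f' * f"
    then obtain z where "f \<in> monogenic z" "f' \<in> monogenic z"
      using common by blast
    then show "f = f'"
      using f monogenic_idempotent_unique by (auto simp: idempotents_def)
  qed
  moreover have ?noCC
    using common_monogenic_imp_no_Cp_Cp[OF common] by blast
  ultimately show "?idem \<and> ?noCC \<and> ?index"
    using common by blast
next
  assume conds: "?idem \<and> ?noCC \<and> ?index"
  have "\<exists>z. x \<in> monogenic z \<and> y \<in> monogenic z" if "x * y = y * x" for x y :: 'a
  proof (cases "sg_index x > 1 \<or> sg_index y > 1")
    case True
    then show ?thesis
      using conds that by blast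
  next
    case False
    then have "\<not> sg_index x > 1" "\<not> sg_index y > 1"
      by blast+
    moreover have "f = f'" if "f * f = f" "f' * f' = f'" "f * f' = f' * f" for f f' :: 'a
      using conds that unfolding idempotents_def by blast
    moreover have "\<not> has_subgroup_iso_to TYPE('a) (integer_mod_group p \<times>\<times> integer_mod_group p)"
      if "prime p" for p :: nat
      using conds that by blast
    ultimately show ?thesis
      using that by (intro periodic_commuting_common_monogenic)
  qed
  then show ?eq
    by (simp add: enhanced_power_graph_eq_commuting_graph_iff)
qed

end
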